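(* Let $r\ge 1$ and $n\ge 0$ be integers. Then the matrix $V_n$ is invertible if and only if $n<r$.
   Context: For the fixed integer $r\ge 1$, put $I_k:=\sum_{c=1}^{r}c^k$ (so $I_0=r$), and let $V_n:=(I_{2i+2j})_{0\le i,j\le n}$, the $(n+1)\times(n+1)$ Hankel matrix with first row $I_0,I_2,\dots,I_{2n}$ and last row $I_{2n},I_{2n+2},\dots,I_{4n}$. *)

theory Defs
  imports "Jordan_Normal_Form.Matrix"
begin

definition power_sum :: "nat \<Rightarrow> nat \<Rightarrow> rat" where
  "power_sum r k = (\<Sum>c = 1..r. of_nat c ^ k)"

text \<open>The entries are integers, but they are taken in the field of rational numbers:
  invertibility is meant over a field, not over the ring of integers.\<close>

definition V_mat :: "nat \<Rightarrow> nat \<Rightarrow> rat mat" where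
  "V_mat r n = mat (n + 1) (n + 1) (\<lambda>(i, j). power_sum r (2 * i + 2 * j))"

end

(* V_n is the Gram matrix of the monomials 1, x, ..., x^n for the symmetric bilinear form
   sum_c p(c^2) q(c^2), where c runs over 1, ..., r.  By positivity its kernel consists of the
   coefficient vectors of those polynomials of degree at most n that vanish at the r distinct
   points c^2, and a nonzero such polynomial exists iff n >= r. *)
theory Submission
  imports Defs "Jordan_Normal_Form.Determinant"
begin

text \<open>An inverse cancels \<open>A\<close> from \<open>A *\<^sub>v v\<close>. Conversely, a
  zero determinant would give a nonzero kernel vector, and over a field a nonzero determinant makes
  \<open>A\<close> a unit of the matrix ring.\<close>

lemma invertible_mat_iff_trivial_kernel:
  fixes A :: "'a :: field mat"
  assumes A: "A \<in> carrier_mat n n"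
  shows "invertible_mat A \<longleftrightarrow> (\<forall>v \<in> carrier_vec n. A *\<^sub>v v = 0\<^sub>v n \<longrightarrow> v = 0\<^sub>v n)"
proof
  assume "invertible_mat A"
  then obtain B where AB: "A * B = 1\<^sub>m n" and BA: "B * A = 1\<^sub>m (dim_row B)"
    using A by (auto simp: invertible_mat_def inverts_mat_def)
  \<comment> \<open>\<open>invertible_mat\<close> does not fix the shape of \<open>B\<close>;
    comparing column counts in both products shows that it is square of size
    \<open>n\<close>.\<close>
  have "dim_col B = n" using arg_cong[OF AB, of dim_col] by simp
  moreover have "dim_row B = n" using arg_cong[OF BA, of dim_col] A by simp
  ultimately have B: "B \<in> carrier_mat n n" and BA: "B * A = 1\<^sub>m n"
    using BA by auto
  show "\<forall>v \<in> carrier_vec n. A *\<^sub>v v = 0\<^sub>v n \<longrightarrow> v = 0\<^sub>v n"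
  proof (intro ballI impI)
    fix v :: "'a vec"
    assume v: "v \<in> carrier_vec n" and Av: "A *\<^sub>v v = 0\<^sub>v n"
    have "v = (B * A) *\<^sub>v v" using BA v by simp
    also have "\<dots> = B *\<^sub>v (A *\<^sub>v v)" using assoc_mult_mat_vec[OF B A v] .
    also have "\<dots> = 0\<^sub>v n" unfolding Av using B by (intro eq_vecI) auto
    finally show "v = 0\<^sub>v n" .
  qed
next
  assume "\<forall>v \<in> carrier_vec n. A *\<^sub>v v = 0\<^sub>v n \<longrightarrow> v = 0\<^sub>v n"
  then have "det A \<noteq> 0" using det_0_iff_vec_prod_zero[OF A] by blast
  from det_non_zero_imp_unit[OF A this, of "()"]
  obtain B where "B \<in> carrier_mat n n" "B * A = 1\<^sub>m n" "A * B = 1\<^sub>m n"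
    by (auto simp: Units_def ring_mat_def)
  then show "invertible_mat A"
    using A by (auto simp: invertible_mat_def inverts_mat_def)
qed

lemma poly_Poly_list_of_vec:
  fixes v :: "'a :: comm_semiring_1 vec"
  shows "poly (Poly (list_of_vec v)) x = (\<Sum>i<dim_vec v. v $ i * x ^ i)"
proof -
  have "poly (Poly xs) x = (\<Sum>i<length xs. xs ! i * x ^ i)" for xs
    \<comment> \<open>This is Horner's scheme: \<open>Poly\<close> peels off the constant term, so
      the sum must be split at its lower end.\<close>
    by (induction xs)
      (simp_all add: sum.lessThan_Suc_shift sum_distrib_left mult_ac del: sum.lessThan_Suc)
  from this[of "list_of_vec v"] show ?thesis
    by (simp add: list_of_vec_index)
qed

lemma coeff_Poly_list_of_vec:
  "coeff (Poly (list_of_vec v)) i = (if i < dim_vec v then v $ i else 0)"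
  by (auto simp: coeff_Poly_eq nth_default_def list_of_vec_index)

text \<open>After the two sums are interchanged, splitting \<open>c ^ (2 * i + 2 * j)\<close> as
  \<open>c ^ (2 * i) * (c ^ 2) ^ j\<close> turns the sum over \<open>j\<close> into a polynomial
  value at \<open>c ^ 2\<close>.\<close>

lemma V_mat_mult_vec:
  assumes "v \<in> carrier_vec (n + 1)"
  shows "V_mat r n *\<^sub>v v =
    vec (n + 1) (\<lambda>i. \<Sum>c = 1..r. of_nat c ^ (2 * i) * poly (Poly (list_of_vec v)) (of_nat c ^ 2))"
proof (rule eq_vecI)
  fix i assume "i < dim_vec (vec (n + 1) (\<lambda>i. \<Sum>c = 1..r. of_nat c ^ (2 * i) *
    poly (Poly (list_of_vec v)) (of_nat c ^ 2)))"
  then have i: "i < n + 1" by simp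
  have "(V_mat r n *\<^sub>v v) $ i = (\<Sum>j<n + 1. \<Sum>c = 1..r. of_nat c ^ (2 * i + 2 * j) * v $ j)"
    using assms i
    by (simp add: V_mat_def power_sum_def scalar_prod_def sum_distrib_right lessThan_atLeast0)
  also have "\<dots> = (\<Sum>c = 1..r. \<Sum>j<n + 1. of_nat c ^ (2 * i + 2 * j) * v $ j)"
    by (rule sum.swap)
  also have "\<dots> = (\<Sum>c = 1..r. of_nat c ^ (2 * i) * poly (Poly (list_of_vec v)) (of_nat c ^ 2))"
    unfolding poly_Poly_list_of_vec carrier_vecD[OF assms] sum_distrib_left power_add power_mult
    by (simp only: mult_ac)
  finally show "(V_mat r n *\<^sub>v v) $ i = vec (n + 1) (\<lambda>i. \<Sum>c = 1..r. of_nat c ^ (2 * i) *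
      poly (Poly (list_of_vec v)) (of_nat c ^ 2)) $ i"
    using i by simp
qed (simp add: V_mat_def)

text \<open>Pairing \<open>V_mat r n *\<^sub>v v\<close> with \<open>v\<close> itself gives the sum
  of the squares of the polynomial values, so a kernel vector makes each value zero.\<close>

lemma V_mat_kernel_iff:
  assumes v: "v \<in> carrier_vec (n + 1)"
  shows "V_mat r n *\<^sub>v v = 0\<^sub>v (n + 1) \<longleftrightarrow>
    (\<forall>c \<in> {1..r}. poly (Poly (list_of_vec v)) (of_nat c ^ 2) = 0)"
proof
  let ?p = "\<lambda>c :: nat. poly (Poly (list_of_vec v)) (of_nat c ^ 2)"
  assume "V_mat r n *\<^sub>v v = 0\<^sub>v (n + 1)"
  then have "(V_mat r n *\<^sub>v v) $ i = 0" if "i < n + 1" for i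
    using that by simp
  then have row: "(\<Sum>c = 1..r. of_nat c ^ (2 * i) * ?p c) = 0" if "i < n + 1" for i
    using that unfolding V_mat_mult_vec[OF v] by simp
  have "(\<Sum>c = 1..r. (?p c)\<^sup>2) = (\<Sum>c = 1..r. \<Sum>i<n + 1. v $ i * (of_nat c ^ (2 * i) * ?p c))"
  proof (rule sum.cong[OF refl])
    fix c :: nat
    \<comment> \<open>Only one of the two factors \<open>?p c\<close> is expanded; the other stays
      to form the row sums.\<close>
    have "(?p c)\<^sup>2 = (\<Sum>i<n + 1. v $ i * (of_nat c ^ 2) ^ i) * ?p c"
      unfolding power2_eq_square[of "?p c"] by (subst poly_Poly_list_of_vec) (use v in simp)
    then show "(?p c)\<^sup>2 = (\<Sum>i<n + 1. v $ i * (of_nat c ^ (2 * i) * ?p c))"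
      by (simp only: sum_distrib_right power_mult mult.assoc)
  qed
  also have "\<dots> = (\<Sum>i<n + 1. v $ i * (\<Sum>c = 1..r. of_nat c ^ (2 * i) * ?p c))"
    unfolding sum_distrib_left by (rule sum.swap)
  also have "\<dots> = 0"
    using row by (intro sum.neutral) auto
  \<comment> \<open>Squares in the ordered field of rationals are nonnegative, so a vanishing sum of
    them has only zero terms.\<close>
  finally show "\<forall>c \<in> {1..r}. ?p c = 0"
    by (subst (asm) sum_nonneg_eq_0_iff) auto
next
  assume "\<forall>c \<in> {1..r}. poly (Poly (list_of_vec v)) (of_nat c ^ 2) = 0"
  then show "V_mat r n *\<^sub>v v = 0\<^sub>v (n + 1)"
    unfolding V_mat_mult_vec[OF v] by (intro eq_vecI) auto
qed

theorem proposition1p1: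
  fixes r n :: nat
  assumes "r \<ge> 1"
  shows "invertible_mat (V_mat r n) \<longleftrightarrow> n < r"
proof -
  define S :: "rat set" where "S = (\<lambda>c. of_nat c ^ 2) ` {1..r}"
  have "inj_on (\<lambda>c. (of_nat c :: rat) ^ 2) {1..r}"
    by (auto simp: inj_on_def power2_eq_iff_nonneg)
  then have card_S: "card S = r"
    unfolding S_def by (simp add: card_image)
  have inv: "invertible_mat (V_mat r n) \<longleftrightarrow> (\<forall>v \<in> carrier_vec (n + 1).
      (\<forall>x \<in> S. poly (Poly (list_of_vec v)) x = 0) \<longrightarrow> v = 0\<^sub>v (n + 1))"
  proof -
    have V: "V_mat r n \<in> carrier_mat (n + 1) (n + 1)"
      by (simp add: V_mat_def)
    show ?thesis
      unfolding invertible_mat_iff_trivial_kernel[OF V] S_def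
      \<comment> \<open>Without \<open>One_nat_def\<close>, \<open>n + 1\<close> keeps the form in
        which \<open>V_mat_kernel_iff\<close> states it.\<close>
      by (auto simp: V_mat_kernel_iff simp del: One_nat_def)
  qed
  show ?thesis
  proof
    assume "n < r"
    show "invertible_mat (V_mat r n)"
      unfolding inv
    proof (intro ballI impI)
      fix v :: "rat vec"
      assume v: "v \<in> carrier_vec (n + 1)" and roots: "\<forall>x \<in> S. poly (Poly (list_of_vec v)) x = 0"
      let ?p = "Poly (list_of_vec v)"
      have coeff: "coeff ?p i = (if i < n + 1 then v $ i else 0)" for i
        using v unfolding coeff_Poly_list_of_vec by simp
      have "degree ?p \<le> n"
        by (rule degree_le) (simp only: coeff, simp)
      have "?p = 0"
      proof (rule ccontr)
        assume "?p \<noteq> 0"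
        \<comment> \<open>The \<open>r\<close> points of \<open>S\<close> are all roots, too many
          for a nonzero polynomial of degree at most \<open>n < r\<close>.\<close>
        have "r \<le> card {x. poly ?p x = 0}"
          unfolding card_S[symmetric]
          using roots \<open>?p \<noteq> 0\<close> by (intro card_mono poly_roots_finite) auto
        also have "\<dots> \<le> degree ?p"
          using \<open>?p \<noteq> 0\<close> by (rule card_poly_roots_bound)
        finally show False
          using \<open>degree ?p \<le> n\<close> \<open>n < r\<close> by simp
      qed
      show "v = 0\<^sub>v (n + 1)"
      proof (rule eq_vecI)
        fix i assume "i < dim_vec (0\<^sub>v (n + 1) :: rat vec)"
        then show "v $ i = 0\<^sub>v (n + 1) $ i"
          using coeff[of i] \<open>?p = 0\<close> by simp
      qed (use v in simp)
    qed
  next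
    assume invertible: "invertible_mat (V_mat r n)"
    show "n < r"
    proof (rule ccontr)
      assume "\<not> n < r"
      \<comment> \<open>The monic polynomial with root set \<open>S\<close> has degree
        \<open>r \<le> n\<close>, so its coefficients fit into a vector of length
        \<open>n + 1\<close> without truncation.\<close>
      define q where "q = (\<Prod>x\<in>S. [:- x, 1:])"
      have "degree q = r"
        unfolding q_def by (subst degree_prod_eq_sum_degree) (auto simp: card_S)
      have "q \<noteq> 0"
        by (simp add: q_def S_def)
      define v where "v = vec (n + 1) (coeff q)"
      have v: "v \<in> carrier_vec (n + 1)"
        by (simp add: v_def)
      have "Poly (list_of_vec v) = q"
      proof (rule poly_eqI)
        fix i
        show "coeff (Poly (list_of_vec v)) i = coeff q i"
          using \<open>degree q = r\<close> \<open>\<not> n < r\<close>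
          unfolding coeff_Poly_list_of_vec by (simp add: v_def coeff_eq_0)
      qed
      moreover have "\<forall>x \<in> S. poly q x = 0"
        by (auto simp: q_def poly_prod S_def)
      ultimately have "v = 0\<^sub>v (n + 1)"
        using invertible v unfolding inv by auto
      \<comment> \<open>Index \<open>r\<close> is within bounds because \<open>r \<le> n\<close>;
        the nonzero leading coefficient stored there contradicts \<open>v\<close> being
        zero.\<close>
      moreover have "v $ r = lead_coeff q"
        using \<open>degree q = r\<close> \<open>\<not> n < r\<close> by (simp add: v_def)
      ultimately show False
        using \<open>q \<noteq> 0\<close> \<open>\<not> n < r\<close> by simp
    qed
  qed
qed

end
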